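(* Let $f:\mathbb{R}^n\to\mathbb{R}$ be twice continuously differentiable with non-empty set $\mathcal{X}^*$ of global minimizers and minimum value $f^*$. Let $x^0\in\mathbb{R}^n$, and suppose that there are a closed convex set $\mathcal{F}\subset\mathbb{R}^n$ with $\mathcal{L}(f(x^0))\subset\operatorname{int}(\mathcal{F})$ and a constant $L>0$ such that $\|\nabla^2 f(x)-\nabla^2 f(y)\|\le L\|x-y\|$ for all $x,y\in\mathcal{F}$. Suppose that $f$ is star-convex and that $\mathcal{X}^*$ is globally non-degenerate. Let $\{x^k\}_{k\ge0}$ be a sequence of iterates generated by the cubic regularization (CR) method from $x^0$. If $\mathcal{L}(f(x^k))$ is bounded for some $k\ge 0$, then the whole sequence $\{x^k\}_{k\ge0}$ converges at least Q-quadratically to a point $x^*\in\mathcal{X}^*$.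
   Context: $\|\cdot\|$ is the Euclidean norm for vectors and the operator norm for matrices; $\operatorname{dist}(x,C)$ is the Euclidean distance from $x$ to $C$. For $x\in\mathbb{R}^n$, $\mathcal{L}(f(x))=\{y\in\mathbb{R}^n: f(y)\le f(x)\}$. $f$ is star-convex if for any $x^*\in\mathcal{X}^*$, $f(\alpha x^*+(1-\alpha)x)\le\alpha f^*+(1-\alpha)f(x)$ for all $x\in\mathbb{R}^n$ and all $\alpha\in[0,1]$. $\mathcal{X}^*$ is globally non-degenerate if there exists $\alpha>0$ such that $f(x)-f^*\ge\frac{\alpha}{2}\operatorname{dist}^2(x,\mathcal{X}^* )$ for all $x\in\mathbb{R}^n$. Cubic model: for $\sigma>0$ and $x,p\in\mathbb{R}^n$, $$f_\sigma(p;x)=f(x)+\nabla f(x)^T(p-x)+\tfrac12(p-x)^T\nabla^2 f(x)(p-x)+\tfrac{\sigma}{6}\|p-x\|^3,$$ $\bar f_\sigma(x)=\min_{p\in\mathbb{R}^n}f_\sigma(p;x)$, and $p_\sigma(x)$ denotes a global minimizer of $f_\sigma(\cdot\,;x)$ over $\mathbb{R}^n$. CR method: given an initial point $x^0$ and a scalar $\bar\sigma\in(0,L]$ (with $L$ the Lipschitz constant of $\nabla^2 f$ on $\mathcal{F}$), for $k=0,1,2,\dots$ find $\sigma_k\in[\bar\sigma,2L]$ such that $f(p_{\sigma_k}(x^k))\le\bar f_{\sigma_k}(x^k)$, and set $x^{k+1}=p_{\sigma_k}(x^k)$. A sequence $\{w^k\}$ converges (at least) Q-quadratically to $w^\infty$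 if $w^k\to w^\infty$ and there exists $M>0$ such that $\|w^{k+1}-w^\infty\|\le M\|w^k-w^\infty\|^2$ for all sufficiently large $k$. *)

theory Defs
  imports "HOL-Analysis.Analysis"
begin

definition gradient :: "(real ^ 'n \<Rightarrow> real) \<Rightarrow> real ^ 'n \<Rightarrow> real ^ 'n" where
  "gradient f x = (THE D. GDERIV f x :> D)"

definition hessian :: "(real ^ 'n \<Rightarrow> real) \<Rightarrow> real ^ 'n \<Rightarrow> real ^ 'n ^ 'n" where
  "hessian f x = jacobian (gradient f) (at x)"

definition twice_continuously_differentiable :: "(real ^ 'n \<Rightarrow> real) \<Rightarrow> bool" where
  "twice_continuously_differentiable f \<longleftrightarrow>
     (\<forall>x. f differentiable (at x)) \<and>
     (\<forall>x. gradient f differentiable (at x)) \<and>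
     continuous_on UNIV (hessian f)"

lemma GDERIV_gradient:
  fixes f :: "real ^ 'n \<Rightarrow> real"
  assumes "f differentiable (at x)"
  shows "GDERIV f x :> gradient f x"
proof -
  obtain f' where f': "(f has_derivative f') (at x)"
    using assms unfolding differentiable_def by blast
  then have "linear f'"
    by (rule has_derivative_linear)
  have "f' h = h \<bullet> adjoint f' 1" for h
    using adjoint_works[OF \<open>linear f'\<close>, of h 1] by simp
  then have f'_eq: "f' = (\<lambda>h. h \<bullet> adjoint f' 1)" by (rule ext)
  have ex: "GDERIV f x :> adjoint f' 1"
    unfolding gderiv_def f'_eq[symmetric] by (rule f')
  have uniq: "D = adjoint f' 1" if D: "GDERIV f x :> D" for D
  proof -
    have eq: "(\<lambda>h. h \<bullet> D) = (\<lambda>h. h \<bullet> adjoint f' 1)"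
      using D ex unfolding gderiv_def by (rule has_derivative_unique)
    have "h \<bullet> D = h \<bullet> adjoint f' 1" for h
      using fun_cong[OF eq, of h] .
    then show ?thesis
      using vector_eq_rdot[of D "adjoint f' 1"] by (simp add: inner_commute)
  qed
  show ?thesis
    unfolding gradient_def by (rule theI[where P = "\<lambda>D. GDERIV f x :> D", OF ex uniq])
qed

lemma has_derivative_gradient_hessian:
  fixes f :: "real ^ 'n \<Rightarrow> real"
  assumes "gradient f differentiable (at x)"
  shows "(gradient f has_derivative (\<lambda>h. hessian f x *v h)) (at x)"
  using assms unfolding hessian_def by (rule iffD1[OF jacobian_works])

definition op_norm :: "real ^ 'n ^ 'm \<Rightarrow> real" where
  "op_norm A = onorm (\<lambda>v. A *v v)"

definition minimizers :: "('a \<Rightarrow> real) \<Rightarrow> 'a set" where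
  "minimizers f = {x. \<forall>y. f x \<le> f y}"

text \<open>The infimum of the range; it is the minimum as soon as \<open>minimizers f\<close> is non-empty,
  and is only meant to be used in that situation.\<close>

definition min_value :: "('a \<Rightarrow> real) \<Rightarrow> real" where
  "min_value f = (INF x. f x)"

lemma min_value_eq:
  assumes "x \<in> minimizers f"
  shows "min_value f = f x"
  unfolding min_value_def
  using assms by (intro cInf_eq_minimum) (auto simp: minimizers_def)

definition sublevel_set :: "('a \<Rightarrow> real) \<Rightarrow> 'a \<Rightarrow> 'a set" where
  "sublevel_set f x = {y. f y \<le> f x}"

definition star_convex :: "(real ^ 'n \<Rightarrow> real) \<Rightarrow> bool" where
  "star_convex f \<longleftrightarrow>
     (\<forall>xs \<in> minimizers f. \<forall>x. \<forall>\<alpha> \<in> {0..1}.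
        f (\<alpha> *\<^sub>R xs + (1 - \<alpha>) *\<^sub>R x) \<le> \<alpha> * min_value f + (1 - \<alpha>) * f x)"

definition globally_nondegenerate :: "(real ^ 'n \<Rightarrow> real) \<Rightarrow> bool" where
  "globally_nondegenerate f \<longleftrightarrow>
     (\<exists>\<alpha>>0. \<forall>x. f x - min_value f \<ge> \<alpha> / 2 * (infdist x (minimizers f))\<^sup>2)"

definition cubic_model :: "(real ^ 'n \<Rightarrow> real) \<Rightarrow> real \<Rightarrow> real ^ 'n \<Rightarrow> real ^ 'n \<Rightarrow> real" where
  "cubic_model f \<sigma> x p =
     f x + gradient f x \<bullet> (p - x) + 1 / 2 * ((p - x) \<bullet> (hessian f x *v (p - x)))
       + \<sigma> / 6 * norm (p - x) ^ 3"

text \<open>The cubic subproblem may have several global minimizers, so the new iterate is any of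
  them, and the iterates are described by a relation rather than computed by a function.\<close>

definition CR_iterates ::
  "(real ^ 'n \<Rightarrow> real) \<Rightarrow> real \<Rightarrow> real \<Rightarrow> real ^ 'n \<Rightarrow> (nat \<Rightarrow> real ^ 'n) \<Rightarrow> bool" where
  "CR_iterates f L sbar x0 x \<longleftrightarrow>
     x 0 = x0 \<and>
     (\<forall>k. \<exists>\<sigma> \<in> {sbar..2 * L}.
        x (Suc k) \<in> minimizers (cubic_model f \<sigma> (x k)) \<and>
        f (x (Suc k)) \<le> min_value (cubic_model f \<sigma> (x k)))"

definition converges_Q_quadratically :: "(nat \<Rightarrow> 'a::real_normed_vector) \<Rightarrow> 'a \<Rightarrow> bool" where
  "converges_Q_quadratically w l \<longleftrightarrow>
     w \<longlonglongrightarrow> l \<and>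
     (\<exists>M>0. \<forall>\<^sub>F k in sequentially. norm (w (Suc k) - l) \<le> M * (norm (w k - l))\<^sup>2)"

end

theory Submission
  imports Defs
begin

text \<open>The idea is to measure progress by the distance \<open>d k\<close> from the \<open>k\<close>-th iterate to the whole
  set of minimizers, not to one point, because the minimizers need not be isolated and the Hessian
  may be singular at them. Three facts about one step carry the proof.

  The step is at most a constant times \<open>d k\<close> (\<open>step_length_le\<close>). Near a minimizer the Hessian is
  almost positive semidefinite, so the quadratic part of the model cannot push the step much further
  than the nearest minimizer: the first-order condition of the model, tested against the difference
  between the step and the vector to that minimizer, leaves the cubic term with nothing large to
  balance it.

  The distance contracts quadratically. The gradient at the new iterate is of the order of the
  squared step (\<open>gradient_at_model_minimizer\<close>), as the model is stationary there and misses the true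
  gradient by a second-order error. Star-convexity together with quadratic growth makes the gradient
  norm dominate the distance to the minimizers (\<open>gradient_error_bound\<close>). Combined with the bound on
  the step this gives \<open>d (Suc k) \<le> B * (d k)\<^sup>2\<close>.

  The distance tends to zero. Comparing the model minimum with the model value at a point part of the
  way towards the nearest minimizer trades a first-order gain from star-convexity against a
  third-order model error (\<open>gap_decrease\<close>), so that the gap in function value shrinks by a fixed
  factor per step; quadratic growth carries this over to the distance.

  Once \<open>d k\<close> is small it at least halves at each step, so the steps are summable, the iterates are
  Cauchy, and the remaining path length from \<open>x (Suc k)\<close> is of the order of \<open>d (Suc k)\<close>, hence of
  \<open>(d k)\<^sup>2\<close> (\<open>convergent_with_quadratic_error\<close>). As the limit is a minimizer, \<open>d k\<close> is at most the
  distance from \<open>x k\<close> to the limit, which is Q-quadratic convergence.\<close>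

section \<open>Scalar and sequence estimates\<close>

text \<open>Turns an expansion to second order with cubic error into a sign for its quadratic coefficient.\<close>

lemma nonpos_if_square_le_cube:
  fixes c K e :: real
  assumes "0 < e" and le: "\<And>t. 0 < t \<Longrightarrow> t < e \<Longrightarrow> c * t ^ 2 \<le> K * t ^ 3"
  shows "c \<le> 0"
proof (rule ccontr)
  assume "\<not> c \<le> 0"
  hence c: "c > 0" by simp
  define t where "t = min (e / 2) (c / (2 * (\<bar>K\<bar> + 1)))"
  have t: "0 < t" "t < e" using c \<open>0 < e\<close> by (auto simp: t_def)
  have "c * t ^ 2 \<le> (K * t) * t ^ 2"
    using le[OF t] by (simp add: power2_eq_square power3_eq_cube mult.assoc)
  hence "c \<le> K * t" using t by simp
  also have "\<dots> \<le> (\<bar>K\<bar> + 1) * t" using t by (intro mult_right_mono) auto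
  also have "\<dots> \<le> (\<bar>K\<bar> + 1) * (c / (2 * (\<bar>K\<bar> + 1)))"
    by (intro mult_left_mono) (auto simp: t_def)
  also have "\<dots> = c / 2" by (simp add: field_simps)
  finally show False using c by simp
qed

text \<open>The arithmetic behind the symmetry of the Hessian. \<open>P\<close> and \<open>Q\<close> stand for the values at \<open>u + a + b\<close>
  and \<open>u + a\<close>, and \<open>p\<close> for the value at \<open>u\<close>. Going to \<open>u + a + b\<close> directly sees the average of the
  mixed terms \<open>X\<close> and \<open>Y\<close>; going through \<open>u + a\<close> sees only \<open>Y\<close>, through the change of the
  gradient. Hence the two agree up to the errors.\<close>

lemma mixed_terms_agree:
  fixes P Q p g h h' A B B' X Y e1 e2 e3 e4 e5 :: real
  assumes "\<bar>P - p - (g + h) - 1 / 2 * (A + X + Y + B)\<bar> \<le> e1"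
    and "\<bar>Q - p - g - 1 / 2 * A\<bar> \<le> e2"
    and "\<bar>P - Q - h' - 1 / 2 * B'\<bar> \<le> e3"
    and "\<bar>h' - h - Y\<bar> \<le> e4" and "\<bar>B' - B\<bar> \<le> e5"
  shows "\<bar>X - Y\<bar> \<le> 2 * e1 + 2 * e2 + 2 * e3 + 2 * e4 + 2 * e5"
  using assms unfolding distrib_left by linarith

lemma has_derivative_norm_cubed:
  fixes y :: "'a::real_inner"
  shows "((\<lambda>y. norm y ^ 3) has_derivative (\<lambda>h. 3 * norm y * (y \<bullet> h))) (at y)"
proof (cases "y = 0")
  case True
  have "((\<lambda>h::'a. norm h ^ 2) \<longlongrightarrow> norm (0::'a) ^ 2) (at 0)"
    by (intro tendsto_intros)
  moreover have "norm h ^ 2 = norm h ^ 3 / norm h" for h :: 'a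
    by (simp add: power2_eq_square power3_eq_cube)
  ultimately show ?thesis using True by (simp add: has_derivative_at)
next
  case False
  have "(norm has_derivative (\<lambda>h. h \<bullet> sgn y)) (at y)"
    by (rule has_derivative_norm[OF False])
  from has_derivative_power[OF this, of 3] show ?thesis
    by (rule has_derivative_subst)
      (auto simp: fun_eq_iff sgn_div_norm power2_eq_square inner_commute False field_simps)
qed

text \<open>Quadratic contraction makes \<open>d\<close> at least halve from some index on, which bounds the whole
  remaining path by a multiple of the current \<open>d\<close>. The error is therefore controlled by \<open>d (Suc k)\<close>,
  hence by \<open>(d k)\<^sup>2\<close>.\<close>

lemma convergent_with_quadratic_error:
  fixes x :: "nat \<Rightarrow> 'a::{real_normed_vector, complete_space}" and d :: "nat \<Rightarrow> real"
  assumes step: "\<And>k. norm (x (Suc k) - x k) \<le> A * d k"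
    and quad: "\<And>k. d (Suc k) \<le> B * (d k)\<^sup>2"
    and d0: "d \<longlonglongrightarrow> 0" and dnn: "\<And>k. 0 \<le> d k"
  shows "\<exists>l. x \<longlonglongrightarrow> l \<and> (\<exists>M>0. \<forall>\<^sub>F k in sequentially. norm (x (Suc k) - l) \<le> M * (d k)\<^sup>2)"
proof -
  \<comment> \<open>Positive replacements for the constants, so that they may be divided by.\<close>
  define A' where "A' = \<bar>A\<bar> + 1"
  define B' where "B' = \<bar>B\<bar> + 1"
  have A': "A' > 0" and B': "B' > 0" by (auto simp: A'_def B'_def)
  have step': "norm (x (Suc k) - x k) \<le> A' * d k" for k
  proof -
    have "A * d k \<le> A' * d k" by (rule mult_right_mono[OF _ dnn]) (auto simp: A'_def)
    thus ?thesis using step[of k] by linarith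
  qed
  have quad': "d (Suc k) \<le> B' * (d k)\<^sup>2" for k
  proof -
    have "B * (d k)\<^sup>2 \<le> B' * (d k)\<^sup>2" by (rule mult_right_mono) (auto simp: B'_def)
    thus ?thesis using quad[of k] by linarith
  qed
  have "\<forall>\<^sub>F k in sequentially. d k < 1 / (2 * B')"
    using order_tendstoD(2)[OF d0] B' by simp
  then obtain K where K: "\<And>k. k \<ge> K \<Longrightarrow> d k < 1 / (2 * B')"
    by (auto simp: eventually_sequentially)
  have half: "d (Suc k) \<le> d k / 2" if "k \<ge> K" for k
  proof -
    have "B' * d k \<le> 1 / 2" using K[OF that] B' by (simp add: field_simps)
    hence "(B' * d k) * d k \<le> 1 / 2 * d k" by (rule mult_right_mono[OF _ dnn])
    thus ?thesis using quad'[of k] by (simp add: power2_eq_square mult.assoc)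
  qed
  \<comment> \<open>Telescoping against the potential \<open>2 * A' * d\<close>, which drops by at least the step length.\<close>
  have tele: "norm (x (k + i) - x k) \<le> 2 * A' * (d k - d (k + i))" if "k \<ge> K" for k i
  proof (induction i)
    case (Suc i)
    have "norm (x (k + Suc i) - x k) \<le> norm (x (Suc (k + i)) - x (k + i)) + norm (x (k + i) - x k)"
      using norm_triangle_ineq[of "x (Suc (k + i)) - x (k + i)" "x (k + i) - x k"] by simp
    also have "\<dots> \<le> A' * d (k + i) + 2 * A' * (d k - d (k + i))"
      using step'[of "k + i"] Suc by linarith
    also have "\<dots> \<le> 2 * A' * (d k - d (k + Suc i))"
    proof -
      have "A' * d (Suc (k + i)) \<le> A' * (d (k + i) / 2)"
        using half[of "k + i"] that A' by (intro mult_left_mono) auto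
      thus ?thesis by (simp add: algebra_simps)
    qed
    finally show ?case .
  qed simp
  have tail: "norm (x (k + i) - x k) \<le> 2 * A' * d k" if "k \<ge> K" for k i
  proof -
    have "0 \<le> A' * d (k + i)" using A' dnn by simp
    thus ?thesis using tele[OF that, of i] by (simp add: algebra_simps)
  qed
  have "Cauchy x"
  proof (rule CauchyI)
    fix e :: real assume e: "0 < e"
    have "\<forall>\<^sub>F k in sequentially. d k < e / (4 * A')"
      using order_tendstoD(2)[OF d0] A' e by simp
    then obtain N where N: "\<And>k. k \<ge> N \<Longrightarrow> d k < e / (4 * A')"
      by (auto simp: eventually_sequentially)
    define m where "m = max N K"
    have small: "norm (x k - x m) < e / 2" if "k \<ge> m" for k
    proof -
      have "norm (x k - x m) \<le> 2 * A' * d m" using tail[of m "k - m"] that by (simp add: m_def)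
      also have "\<dots> < e / 2" using N[of m] A' by (simp add: m_def field_simps)
      finally show ?thesis .
    qed
    have "norm (x k - x j) < e" if "k \<ge> m" "j \<ge> m" for k j
      using small[OF that(1)] small[OF that(2)] norm_triangle_ineq4[of "x k - x m" "x j - x m"]
      by simp
    thus "\<exists>M. \<forall>m\<ge>M. \<forall>n\<ge>M. norm (x m - x n) < e" by blast
  qed
  then obtain l where l: "x \<longlonglongrightarrow> l" using Cauchy_convergent_iff convergent_def by blast
  have lim: "norm (x k - l) \<le> 2 * A' * d k" if "k \<ge> K" for k
  proof -
    have "(\<lambda>i. norm (x (i + k) - x k)) \<longlonglongrightarrow> norm (l - x k)"
      by (intro tendsto_intros LIMSEQ_ignore_initial_segment l)
    hence "norm (l - x k) \<le> 2 * A' * d k"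
      by (rule LIMSEQ_le_const2) (use tail[OF that] in \<open>auto simp: add.commute\<close>)
    thus ?thesis by (simp add: norm_minus_commute)
  qed
  have "norm (x (Suc k) - l) \<le> (2 * A' * B') * (d k)\<^sup>2" if "k \<ge> K" for k
  proof -
    have "norm (x (Suc k) - l) \<le> 2 * A' * d (Suc k)" using lim[of "Suc k"] that by simp
    also have "\<dots> \<le> 2 * A' * (B' * (d k)\<^sup>2)" using quad' A' by (intro mult_left_mono) auto
    finally show ?thesis by (simp add: mult.assoc)
  qed
  hence "\<forall>\<^sub>F k in sequentially. norm (x (Suc k) - l) \<le> (2 * A' * B') * (d k)\<^sup>2"
    unfolding eventually_sequentially by blast
  moreover have "2 * A' * B' > 0" using A' B' by simp
  ultimately show ?thesis using l by blast
qed

text \<open>The gain is linear in \<open>t\<close> and the loss cubic, and growth bounds \<open>d\<close> along the whole sequence. A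
  sufficiently small \<open>t\<close>, the same for all \<open>k\<close>, therefore loses at most half of the gain, and the gap
  decays geometrically.\<close>

lemma gap_tendsto_zero_if_cubic_tradeoff:
  fixes \<delta> d :: "nat \<Rightarrow> real"
  assumes dec: "\<And>k t. 0 \<le> t \<Longrightarrow> t \<le> 1 \<Longrightarrow> \<delta> (Suc k) \<le> (1 - t) * \<delta> k + c * (t * d k) ^ 3"
    and growth: "\<And>k. (d k)\<^sup>2 \<le> b * \<delta> k" and "0 < c" "0 < b"
    and dnn: "\<And>k. 0 \<le> d k" and \<delta>nn: "\<And>k. 0 \<le> \<delta> k"
  shows "\<delta> \<longlonglongrightarrow> 0"
proof -
  have mono: "\<delta> (Suc k) \<le> \<delta> k" for k using dec[of 0 k] by simp
  hence \<delta>0: "\<delta> k \<le> \<delta> 0" for k by (induction k) (auto intro: order_trans)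
  define D where "D = sqrt (b * \<delta> 0)"
  have dD: "d k \<le> D" for k
  proof -
    have "(d k)\<^sup>2 \<le> b * \<delta> 0" using growth[of k] \<delta>0[of k] \<open>0 < b\<close>
      by (meson mult_left_mono order_trans less_imp_le)
    thus ?thesis unfolding D_def by (rule real_le_rsqrt)
  qed
  have Dnn: "0 \<le> D" using dD[of 0] dnn[of 0] by linarith
  \<comment> \<open>The choice of \<open>m\<close> makes \<open>c * b * D * t \<le> 1 / 2\<close>, which is the factor lost against the gain.\<close>
  define m where "m = 1 + 2 * c * b * D"
  define t where "t = 1 / m"
  have m: "m \<ge> 1" using Dnn \<open>0 < c\<close> \<open>0 < b\<close> by (simp add: m_def)
  have t: "0 < t" "t \<le> 1" using m by (auto simp: t_def)
  have "c * b * D * t \<le> 1 / 2" using m by (simp add: t_def field_simps m_def)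
  have step: "\<delta> (Suc k) \<le> (1 - t / 2) * \<delta> k" for k
  proof -
    have "c * (t * d k) ^ 3 = (c * t ^ 3 * d k) * (d k)\<^sup>2"
      by (simp add: power_mult_distrib power2_eq_square power3_eq_cube)
    also have "\<dots> \<le> (c * t ^ 3 * d k) * (b * \<delta> k)"
      using growth t dnn \<open>0 < c\<close> by (intro mult_left_mono) auto
    also have "\<dots> = (c * b * t ^ 3 * \<delta> k) * d k" by simp
    also have "\<dots> \<le> (c * b * t ^ 3 * \<delta> k) * D"
      using dD t \<delta>nn \<open>0 < c\<close> \<open>0 < b\<close> by (intro mult_left_mono) auto
    also have "\<dots> = (c * b * D * t) * (t\<^sup>2 * \<delta> k)"
      by (simp add: power2_eq_square power3_eq_cube)
    also have "\<dots> \<le> 1 / 2 * (t * \<delta> k)"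
    proof (rule mult_mono)
      show "t\<^sup>2 * \<delta> k \<le> t * \<delta> k"
        using t \<delta>nn by (intro mult_right_mono) (auto simp: power2_eq_square mult_left_le)
    qed (use \<open>c * b * D * t \<le> 1 / 2\<close> t \<delta>nn in auto)
    finally show ?thesis using dec[of t k] t by (simp add: algebra_simps)
  qed
  have geo: "\<delta> k \<le> (1 - t / 2) ^ k * \<delta> 0" for k
  proof (induction k)
    case (Suc k)
    have "\<delta> (Suc k) \<le> (1 - t / 2) * \<delta> k" by (rule step)
    also have "\<dots> \<le> (1 - t / 2) * ((1 - t / 2) ^ k * \<delta> 0)"
      using Suc t by (intro mult_left_mono) auto
    finally show ?case by simp
  qed simp
  have "(\<lambda>k. (1 - t / 2) ^ k * \<delta> 0) \<longlonglongrightarrow> 0"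
    using t by (intro tendsto_mult_left_zero LIMSEQ_power_zero) auto
  from tendsto_sandwich[OF _ _ tendsto_const this] show ?thesis
    using geo \<delta>nn by (metis (mono_tags, lifting) eventually_sequentiallyI)
qed

section \<open>Functions with Lipschitz continuous Hessian\<close>

locale lipschitz_hessian =
  fixes f :: "real ^ 'n \<Rightarrow> real" and F :: "(real ^ 'n) set" and L :: real
  assumes C2: "twice_continuously_differentiable f"
    and convex_F: "convex F"
    and L_pos: "0 < L"
    and lip: "\<forall>y\<in>F. \<forall>z\<in>F. op_norm (hessian f y - hessian f z) \<le> L * norm (y - z)"
begin

lemma has_derivative_f: "(f has_derivative (\<lambda>h. h \<bullet> gradient f y)) (at y)"
  using C2 GDERIV_gradient[of f y]
  by (simp add: twice_continuously_differentiable_def gderiv_def)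

lemma has_derivative_gradient:
  "(gradient f has_derivative (\<lambda>h. hessian f y *v h)) (at y)"
  using C2 by (intro has_derivative_gradient_hessian)
    (simp add: twice_continuously_differentiable_def)

lemma has_real_derivative_line:
  "((\<lambda>t. f (y + t *\<^sub>R h)) has_real_derivative (gradient f (y + t *\<^sub>R h) \<bullet> h)) (at t)"
proof -
  have "((\<lambda>t. y + t *\<^sub>R h) has_derivative (\<lambda>s. s *\<^sub>R h)) (at t)"
    by (auto intro!: derivative_eq_intros)
  from has_derivative_compose[OF this has_derivative_f] show ?thesis
    by (simp add: has_field_derivative_def inner_commute mult.commute[of _ "inner _ _"])
qed

lemma continuous_f: "continuous_on S f"
  using has_derivative_f has_derivative_continuous continuous_at_imp_continuous_on by blast

lemma norm_hessian_diff_le: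
  assumes "y \<in> F" "z \<in> F"
  shows "norm (hessian f y *v h - hessian f z *v h) \<le> L * norm (y - z) * norm h"
proof -
  have "norm ((hessian f y - hessian f z) *v h) \<le> op_norm (hessian f y - hessian f z) * norm h"
    unfolding op_norm_def by (rule onorm) (rule matrix_vector_mul_bounded_linear)
  also have "\<dots> \<le> L * norm (y - z) * norm h"
    using lip assms by (intro mult_right_mono) auto
  finally show ?thesis by (simp add: matrix_vector_mult_diff_rdistrib)
qed

lemma hessian_form_diff_le:
  assumes "y \<in> F" "z \<in> F"
  shows "\<bar>h \<bullet> (hessian f y *v h) - h \<bullet> (hessian f z *v h)\<bar> \<le> L * norm (y - z) * norm h ^ 2"
proof -
  have "\<bar>h \<bullet> (hessian f y *v h) - h \<bullet> (hessian f z *v h)\<bar>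
      \<le> norm h * norm (hessian f y *v h - hessian f z *v h)"
    by (metis Cauchy_Schwarz_ineq2 inner_diff_right)
  also have "\<dots> \<le> norm h * (L * norm (y - z) * norm h)"
    using norm_hessian_diff_le[OF assms] by (intro mult_left_mono) auto
  finally show ?thesis by (simp add: power2_eq_square mult_ac)
qed

text \<open>The remainders in this lemma and the next come from the mean value theorem and not from integrating,
  which costs a constant factor: \<open>L\<close> in place of \<open>L / 2\<close> here and of \<open>L / 6\<close> there. Only the
  orders of magnitude matter for what follows.\<close>

lemma gradient_taylor:
  assumes "y \<in> F" "y + h \<in> F"
  shows "norm (gradient f (y + h) - gradient f y - hessian f y *v h) \<le> L * norm h ^ 2"
proof -
  have seg: "y + t *\<^sub>R h \<in> F" if "t \<in> {0..1}" for t
    using convexD_alt[OF convex_F assms, of t] that by (simp add: algebra_simps)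
  have "norm (gradient f (y + h) - gradient f y - (\<lambda>v. hessian f y *v v) (y + h - y))
     \<le> norm (y + h - y) * (L * norm h)"
  proof (rule differentiable_bound_linearization
      [where S = "(\<lambda>t. y + t *\<^sub>R h) ` {0..1}" and f' = "\<lambda>u v. hessian f u *v v"])
    fix u assume "u \<in> (\<lambda>t. y + t *\<^sub>R h) ` {0..1}"
    then obtain t where t: "t \<in> {0..1}" "u = y + t *\<^sub>R h" by auto
    show "(gradient f has_derivative (*v) (hessian f u)) (at u within (\<lambda>t. y + t *\<^sub>R h) ` {0..1})"
      using has_derivative_gradient by (rule has_derivative_at_withinI)
    have "u \<in> F" using seg t by blast
    have "norm (u - y) \<le> norm h" using t by (simp add: mult_left_le_one_le)
    hence "L * norm (u - y) * norm v \<le> L * norm h * norm v" for v :: "real ^ 'n"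
      using L_pos by (intro mult_right_mono mult_left_mono) auto
    hence "norm (hessian f u *v v - hessian f y *v v) \<le> L * norm h * norm v" for v
      using norm_hessian_diff_le[OF \<open>u \<in> F\<close> assms(1), of v] order_trans by blast
    thus "onorm ((*v) (hessian f u) - (*v) (hessian f y)) \<le> L * norm h"
      using L_pos by (intro onorm_bound) auto
  qed (auto intro: image_eqI[of _ _ 0])
  thus ?thesis by (simp add: power2_eq_square mult_ac)
qed

lemma taylor:
  assumes "y \<in> F" "y + h \<in> F"
  shows "\<bar>f (y + h) - f y - gradient f y \<bullet> h - 1 / 2 * (h \<bullet> (hessian f y *v h))\<bar>
    \<le> L * norm h ^ 3"
proof -
  let ?g = "gradient f" and ?q = "h \<bullet> (hessian f y *v h)"
  \<comment> \<open>Expanding along the segment avoids differentiating the quadratic form as a function of \<open>h\<close>,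
    which would presuppose the symmetry of the Hessian.\<close>
  define \<psi> where "\<psi> t = f (y + t *\<^sub>R h) - t * (?g y \<bullet> h) - t\<^sup>2 / 2 * ?q" for t
  have "(\<psi> has_real_derivative (?g (y + t *\<^sub>R h) \<bullet> h - ?g y \<bullet> h - t * ?q)) (at t)" for t
    unfolding \<psi>_def[abs_def] by (auto intro!: derivative_eq_intros has_real_derivative_line)
  then obtain t where t: "0 < t" "t < 1"
    and eq: "\<psi> 1 - \<psi> 0 = (1 - 0) * (?g (y + t *\<^sub>R h) \<bullet> h - ?g y \<bullet> h - t * ?q)"
    using MVT2[of 0 1 \<psi> "\<lambda>t. ?g (y + t *\<^sub>R h) \<bullet> h - ?g y \<bullet> h - t * ?q"] by auto
  have F: "y + t *\<^sub>R h \<in> F"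
    using convexD_alt[OF convex_F assms, of t] t by (simp add: algebra_simps)
  have "\<psi> 1 - \<psi> 0 = (?g (y + t *\<^sub>R h) - ?g y - hessian f y *v (t *\<^sub>R h)) \<bullet> h"
    by (simp add: eq inner_diff_left matrix_vector_mult_scaleR inner_commute[of _ h] inner_diff_right)
  also have "\<bar>\<dots>\<bar> \<le> norm (?g (y + t *\<^sub>R h) - ?g y - hessian f y *v (t *\<^sub>R h)) * norm h"
    by (rule Cauchy_Schwarz_ineq2)
  also have "\<dots> \<le> (L * norm (t *\<^sub>R h) ^ 2) * norm h"
    by (intro mult_right_mono gradient_taylor assms F) auto
  also have "\<dots> \<le> (L * norm h ^ 2) * norm h"
    using t L_pos by (intro mult_right_mono mult_left_mono power_mono)
      (auto simp: mult_left_le_one_le)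
  finally show ?thesis
    by (simp add: \<psi>_def power2_eq_square power3_eq_cube mult_ac)
qed

lemma small_steps_in_interior:
  assumes "u \<in> interior F"
  obtains e where "e > 0"
    "\<And>t. 0 < t \<Longrightarrow> t < e \<Longrightarrow> u + t *\<^sub>R a \<in> F \<and> u + t *\<^sub>R (a + b) \<in> F"
proof -
  obtain r where r: "r > 0" "ball u r \<subseteq> F" using assms mem_interior by blast
  define n where "n = norm a + norm b + 1"
  have n: "n > 0" by (simp add: n_def add_nonneg_pos)
  have "u + t *\<^sub>R v \<in> F" if "0 < t" "t < r / n" "norm v \<le> n" for t v
  proof -
    have "t * norm v \<le> t * n" using that by (intro mult_left_mono) auto
    also have "\<dots> < r" using that n by (simp add: field_simps)
    finally show ?thesis using r that by (auto simp: dist_norm)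
  qed
  moreover have "norm a \<le> n" "norm (a + b) \<le> n"
    using norm_triangle_ineq[of a b] by (auto simp: n_def add_increasing2)
  ultimately show ?thesis using that[of "r / n"] r n by simp
qed

text \<open>Symmetry is needed to differentiate the quadratic part of the cubic model. It follows by computing
  \<open>f (u + t *\<^sub>R (a + b))\<close> in two ways, from \<open>u\<close> and from \<open>u + t *\<^sub>R a\<close>: the results differ by half the
  difference of the mixed terms, of order \<open>t\<^sup>2\<close>, while all errors are of order \<open>t ^ 3\<close>.\<close>

lemma hessian_symmetric:
  assumes "u \<in> interior F"
  shows "a \<bullet> (hessian f u *v b) = b \<bullet> (hessian f u *v a)"
proof -
  let ?H = "hessian f" and ?g = "gradient f"
  define K where "K = 2 * (L * norm (a + b) ^ 3 + L * norm a ^ 3 + L * norm b ^ 3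
    + L * norm a ^ 2 * norm b + L * norm a * norm b ^ 2)"
  obtain e where e: "e > 0"
    "\<And>t. 0 < t \<Longrightarrow> t < e \<Longrightarrow> u + t *\<^sub>R a \<in> F \<and> u + t *\<^sub>R (a + b) \<in> F"
    using small_steps_in_interior[OF assms, of a b] by blast
  have uF: "u \<in> F" using assms interior_subset by blast
  have "\<bar>a \<bullet> (?H u *v b) - b \<bullet> (?H u *v a)\<bar> * t ^ 2 \<le> K * t ^ 3" if t: "0 < t" "t < e" for t
  proof -
    let ?v = "u + t *\<^sub>R a"
    have vF: "?v \<in> F" and wF: "u + t *\<^sub>R (a + b) \<in> F" using e(2)[OF t] by auto
    have wF': "?v + t *\<^sub>R b \<in> F" using wF by (simp add: scaleR_add_right add.assoc)
    have T1: "\<bar>f (u + t *\<^sub>R (a + b)) - f u - t * (?g u \<bullet> (a + b))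
        - 1 / 2 * (t\<^sup>2 * ((a + b) \<bullet> (?H u *v (a + b))))\<bar> \<le> L * norm (a + b) ^ 3 * t ^ 3"
      using taylor[OF uF wF] t
      by (simp add: matrix_vector_mult_scaleR power_mult_distrib power2_eq_square mult_ac)
    have T2: "\<bar>f ?v - f u - t * (?g u \<bullet> a) - 1 / 2 * (t\<^sup>2 * (a \<bullet> (?H u *v a)))\<bar>
        \<le> L * norm a ^ 3 * t ^ 3"
      using taylor[OF uF vF] t
      by (simp add: matrix_vector_mult_scaleR power_mult_distrib power2_eq_square mult_ac)
    have T3: "\<bar>f (u + t *\<^sub>R (a + b)) - f ?v - t * (?g ?v \<bullet> b) - 1 / 2 * (t\<^sup>2 * (b \<bullet> (?H ?v *v b)))\<bar>
        \<le> L * norm b ^ 3 * t ^ 3"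
      using taylor[OF vF wF'] t
      by (simp add: matrix_vector_mult_scaleR power_mult_distrib power2_eq_square mult_ac
          scaleR_add_right add.assoc)
    have "\<bar>(?g ?v - ?g u - ?H u *v (t *\<^sub>R a)) \<bullet> b\<bar>
        \<le> norm (?g ?v - ?g u - ?H u *v (t *\<^sub>R a)) * norm b"
      by (rule Cauchy_Schwarz_ineq2)
    also have "\<dots> \<le> (L * norm (t *\<^sub>R a) ^ 2) * norm b"
      by (intro mult_right_mono gradient_taylor uF vF) auto
    finally have "t * \<bar>?g ?v \<bullet> b - ?g u \<bullet> b - t * (b \<bullet> (?H u *v a))\<bar>
        \<le> t * (L * norm (t *\<^sub>R a) ^ 2 * norm b)"
      using t by (intro mult_left_mono)
        (simp_all add: inner_diff_left matrix_vector_mult_scaleR inner_commute[of _ b] inner_diff_right)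
    hence "\<bar>t * (?g ?v \<bullet> b - ?g u \<bullet> b - t * (b \<bullet> (?H u *v a)))\<bar>
        \<le> t * (L * norm (t *\<^sub>R a) ^ 2 * norm b)"
      using t by (simp add: abs_mult)
    hence T4: "\<bar>t * (?g ?v \<bullet> b) - t * (?g u \<bullet> b) - t\<^sup>2 * (b \<bullet> (?H u *v a))\<bar>
        \<le> L * norm a ^ 2 * norm b * t ^ 3"
      using t by (simp add: algebra_simps power2_eq_square power3_eq_cube)
    have "\<bar>b \<bullet> (?H ?v *v b) - b \<bullet> (?H u *v b)\<bar> \<le> L * norm (?v - u) * norm b ^ 2"
      by (rule hessian_form_diff_le[OF vF uF])
    hence "t\<^sup>2 * \<bar>b \<bullet> (?H ?v *v b) - b \<bullet> (?H u *v b)\<bar> \<le> t\<^sup>2 * (L * norm (?v - u) * norm b ^ 2)"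
      by (intro mult_left_mono) auto
    hence "\<bar>t\<^sup>2 * (b \<bullet> (?H ?v *v b) - b \<bullet> (?H u *v b))\<bar> \<le> t\<^sup>2 * (L * norm (?v - u) * norm b ^ 2)"
      by (simp add: abs_mult)
    hence T5: "\<bar>t\<^sup>2 * (b \<bullet> (?H ?v *v b)) - t\<^sup>2 * (b \<bullet> (?H u *v b))\<bar> \<le> L * norm a * norm b ^ 2 * t ^ 3"
      using t by (simp add: algebra_simps power2_eq_square power3_eq_cube)
    have E: "t\<^sup>2 * ((a + b) \<bullet> (?H u *v (a + b))) = t\<^sup>2 * (a \<bullet> (?H u *v a)) + t\<^sup>2 * (a \<bullet> (?H u *v b))
        + t\<^sup>2 * (b \<bullet> (?H u *v a)) + t\<^sup>2 * (b \<bullet> (?H u *v b))"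
      "t * (?g u \<bullet> (a + b)) = t * (?g u \<bullet> a) + t * (?g u \<bullet> b)"
      by (simp_all add: matrix_vector_right_distrib inner_add_left inner_add_right algebra_simps)
    have "\<bar>t\<^sup>2 * (a \<bullet> (?H u *v b)) - t\<^sup>2 * (b \<bullet> (?H u *v a))\<bar> \<le> 2 * (L * norm (a + b) ^ 3 * t ^ 3)
        + 2 * (L * norm a ^ 3 * t ^ 3) + 2 * (L * norm b ^ 3 * t ^ 3)
        + 2 * (L * norm a ^ 2 * norm b * t ^ 3) + 2 * (L * norm a * norm b ^ 2 * t ^ 3)"
      using mixed_terms_agree[OF T1[unfolded E] T2 T3 T4 T5] .
    also have "\<dots> = K * t ^ 3" by (simp add: K_def algebra_simps)
    also have "t\<^sup>2 * (a \<bullet> (?H u *v b)) - t\<^sup>2 * (b \<bullet> (?H u *v a))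
        = t\<^sup>2 * (a \<bullet> (?H u *v b) - b \<bullet> (?H u *v a))" by (simp add: algebra_simps)
    finally show ?thesis by (simp add: abs_mult mult.commute)
  qed
  from nonpos_if_square_le_cube[OF e(1) this] show ?thesis by simp
qed

lemma gradient_minimizer:
  assumes "u \<in> minimizers f"
  shows "gradient f u = 0"
proof -
  have "(\<lambda>h. h \<bullet> gradient f u) = (\<lambda>h. 0)"
    using assms by (intro has_derivative_local_min[OF has_derivative_f])
      (simp add: minimizers_def)
  from fun_cong[OF this, of "gradient f u"] show ?thesis by simp
qed

lemma hessian_nonneg_minimizer:
  assumes u: "u \<in> minimizers f" and int: "u \<in> interior F"
  shows "0 \<le> a \<bullet> (hessian f u *v a)"
proof -
  have uF: "u \<in> F" using int interior_subset by blast
  obtain e where e: "e > 0" "\<And>t. 0 < t \<Longrightarrow> t < e \<Longrightarrow> u + t *\<^sub>R a \<in> F"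
    using small_steps_in_interior[OF int, of a 0] by metis
  have "- (1 / 2 * (a \<bullet> (hessian f u *v a))) * t ^ 2 \<le> L * norm a ^ 3 * t ^ 3"
    if t: "0 < t" "t < e" for t
  proof -
    have "f u \<le> f (u + t *\<^sub>R a)" using u by (simp add: minimizers_def)
    thus ?thesis
      using taylor[OF uF e(2)[OF t]] t
      by (simp add: gradient_minimizer[OF u] matrix_vector_mult_scaleR power_mult_distrib
          power2_eq_square mult_ac)
  qed
  from nonpos_if_square_le_cube[OF e(1) this] show ?thesis by simp
qed

section \<open>One step of the method\<close>

lemma cubic_model_first_order:
  assumes y: "y \<in> interior F" and p: "p \<in> minimizers (cubic_model f \<sigma> y)"
  shows "gradient f y + hessian f y *v (p - y) + (\<sigma> / 2 * norm (p - y)) *\<^sub>R (p - y) = 0"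
proof -
  let ?H = "hessian f y" and ?g = "gradient f y"
  let ?G = "?g + ?H *v (p - y) + (\<sigma> / 2 * norm (p - y)) *\<^sub>R (p - y)"
  have D: "((\<lambda>p. p - y) has_derivative (\<lambda>h. h)) (at p)"
    by (auto intro!: derivative_eq_intros)
  note N = has_derivative_compose[OF D has_derivative_norm_cubed]
  note Q = has_derivative_inner[OF D has_derivative_compose
      [OF D bounded_linear_imp_has_derivative[OF matrix_vector_mul_bounded_linear[of ?H]]]]
  have "(cubic_model f \<sigma> y has_derivative (\<lambda>h. 0 + ?g \<bullet> h
      + 1 / 2 * ((p - y) \<bullet> (?H *v h) + h \<bullet> (?H *v (p - y)))
      + \<sigma> / 6 * (3 * norm (p - y) * ((p - y) \<bullet> h)))) (at p)"
    unfolding cubic_model_def[abs_def]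
    by (intro has_derivative_add has_derivative_const has_derivative_inner_right D
        has_derivative_mult_right N Q)
  also have "(\<lambda>h. 0 + ?g \<bullet> h + 1 / 2 * ((p - y) \<bullet> (?H *v h) + h \<bullet> (?H *v (p - y)))
      + \<sigma> / 6 * (3 * norm (p - y) * ((p - y) \<bullet> h))) = (\<lambda>h. ?G \<bullet> h)"
    by (simp add: fun_eq_iff inner_add_left hessian_symmetric[OF y, of "p - y"]
        inner_commute[of "?H *v (p - y)"])
  finally have "(cubic_model f \<sigma> y has_derivative (\<lambda>h. ?G \<bullet> h)) (at p)" .
  moreover have "\<forall>\<^sub>F q in at p. cubic_model f \<sigma> y p \<le> cubic_model f \<sigma> y q"
    using p by (simp add: minimizers_def)
  ultimately have "(\<lambda>h. ?G \<bullet> h) = (\<lambda>h. 0)" by (rule has_derivative_local_min)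
  from fun_cong[OF this, of ?G] show ?thesis by simp
qed

text \<open>The Taylor error and the cubic regularizer are both of third order, so a minimal value of the model
  is never much worse than the value of \<open>f\<close> at a competitor.\<close>

lemma cubic_model_le:
  assumes "y \<in> F" "p \<in> F" "\<sigma> \<le> 2 * L"
  shows "cubic_model f \<sigma> y p \<le> f p + 2 * L * norm (p - y) ^ 3"
proof -
  have "\<sigma> / 6 * norm (p - y) ^ 3 \<le> L * norm (p - y) ^ 3"
    using assms(3) L_pos by (intro mult_right_mono) auto
  thus ?thesis using taylor[of y "p - y"] assms unfolding cubic_model_def by simp
qed

text \<open>Stationarity of the model cancels the linearized gradient at \<open>p\<close>; what is left is the
  linearization error and the gradient of the cubic term, both quadratic in the step.\<close>

lemma gradient_at_model_minimizer:
  assumes y: "y \<in> interior F" and p: "p \<in> minimizers (cubic_model f \<sigma> y)" and "p \<in> F"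
    and \<sigma>: "0 < \<sigma>" "\<sigma> \<le> 2 * L"
  shows "norm (gradient f p) \<le> 2 * L * norm (p - y) ^ 2"
proof -
  let ?s = "p - y"
  have yF: "y \<in> F" using y interior_subset by blast
  have "gradient f p = (gradient f p - gradient f y - hessian f y *v ?s) - (\<sigma> / 2 * norm ?s) *\<^sub>R ?s"
    using cubic_model_first_order[OF y p] by (simp add: algebra_simps add_eq_0_iff)
  also have "norm \<dots> \<le> norm (gradient f p - gradient f y - hessian f y *v ?s)
      + norm ((\<sigma> / 2 * norm ?s) *\<^sub>R ?s)"
    by (rule norm_triangle_ineq4)
  also have "\<dots> \<le> L * norm ?s ^ 2 + L * norm ?s ^ 2"
  proof (rule add_mono)
    show "norm (gradient f p - gradient f y - hessian f y *v ?s) \<le> L * norm ?s ^ 2"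
      using gradient_taylor[of y ?s] yF \<open>p \<in> F\<close> by simp
    have "norm ((\<sigma> / 2 * norm ?s) *\<^sub>R ?s) = \<sigma> / 2 * norm ?s ^ 2"
      using \<sigma> by (simp add: power2_eq_square)
    also have "\<dots> \<le> L * norm ?s ^ 2" using \<sigma> by (intro mult_right_mono) auto
    finally show "norm ((\<sigma> / 2 * norm ?s) *\<^sub>R ?s) \<le> L * norm ?s ^ 2" .
  qed
  finally show ?thesis by simp
qed

text \<open>With \<open>s\<close> the step and \<open>v\<close> the vector to the minimizer, subtract the linearization of the gradient
  at \<open>v\<close>, which vanishes up to order \<open>(norm v)\<^sup>2\<close>, from the first-order condition at \<open>s\<close>, and test
  with \<open>s - v\<close>. The Hessian at \<open>y\<close> is at least \<open>- L * norm v\<close>, since at \<open>u\<close> it is positive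
  semidefinite. This bounds the cubic term, of order
  \<open>\<sigma> * (norm s)\<^sup>2 * (norm s - norm v)\<close>, by \<open>L * norm v * (norm s)\<^sup>2\<close> up to a constant as soon as
  \<open>norm s \<ge> norm v\<close>, and \<open>norm s\<close> cannot exceed \<open>norm v\<close> by more than a multiple of \<open>norm v\<close>.\<close>

lemma step_length_le:
  assumes y: "y \<in> interior F" and p: "p \<in> minimizers (cubic_model f \<sigma> y)"
    and u: "u \<in> minimizers f" "u \<in> interior F" and \<sigma>: "0 < \<sigma>"
  shows "norm (p - y) \<le> (1 + 12 * L / \<sigma>) * norm (u - y)"
proof -
  let ?H = "hessian f y"
  define s where "s = p - y"
  define v where "v = u - y"
  define w where "w = s - v"
  define r where "r = norm s"
  define d where "d = norm v"
  define e where "e = gradient f y + ?H *v v"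
  have nn: "0 \<le> r" "0 \<le> d" by (auto simp: r_def d_def)
  have F: "y \<in> F" "u \<in> F" using y u interior_subset by blast+
  have e: "norm e \<le> L * d ^ 2"
  proof -
    have "- e = gradient f (y + v) - gradient f y - hessian f y *v v"
      by (simp add: e_def v_def gradient_minimizer[OF u(1)])
    hence "norm (- e) \<le> L * d ^ 2"
      using gradient_taylor[of y v] F by (simp add: v_def d_def)
    thus ?thesis by simp
  qed
  have w: "norm w \<le> r + d"
    using norm_triangle_ineq4[of s v] by (simp add: w_def r_def d_def)
  have "e + ?H *v w + (\<sigma> / 2 * r) *\<^sub>R s = 0"
    using cubic_model_first_order[OF y p]
    by (simp add: e_def w_def s_def r_def matrix_vector_mult_diff_distrib)
  hence "w \<bullet> (e + ?H *v w + (\<sigma> / 2 * r) *\<^sub>R s) = 0" by simp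
  hence eq: "\<sigma> / 2 * r * (w \<bullet> s) = - (w \<bullet> e) - w \<bullet> (?H *v w)"
    by (simp add: inner_add_right algebra_simps)
  have "0 \<le> w \<bullet> (hessian f u *v w)" by (rule hessian_nonneg_minimizer[OF u])
  hence "- (w \<bullet> (?H *v w)) \<le> L * d * norm w ^ 2"
    using hessian_form_diff_le[OF F(2) F(1), of w] by (simp add: d_def v_def)
  also have "\<dots> \<le> L * d * (r + d) ^ 2"
    using w L_pos nn by (intro mult_left_mono power_mono) auto
  finally have q: "- (w \<bullet> (?H *v w)) \<le> L * d * (r + d) ^ 2" .
  have "- (w \<bullet> e) \<le> norm w * norm e" using Cauchy_Schwarz_ineq2[of w e] by linarith
  also have "\<dots> \<le> (r + d) * (L * d ^ 2)"
    using w e nn by (intro mult_mono) auto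
  finally have we: "- (w \<bullet> e) \<le> (r + d) * (L * d ^ 2)" .
  have "v \<bullet> s \<le> r * d" using norm_cauchy_schwarz[of v s] by (simp add: r_def d_def mult.commute)
  hence "r * (r - d) \<le> w \<bullet> s"
    by (simp add: w_def inner_diff_left r_def power2_norm_eq_inner[symmetric] power2_eq_square
        algebra_simps)
  hence "\<sigma> / 2 * r * (r * (r - d)) \<le> \<sigma> / 2 * r * (w \<bullet> s)"
    using \<sigma> nn by (intro mult_left_mono) auto
  with eq q we have main: "\<sigma> / 2 * r * (r * (r - d)) \<le> (r + d) * (L * d ^ 2) + L * d * (r + d) ^ 2"
    by linarith
  have "r \<le> (1 + 12 * L / \<sigma>) * d"
  proof (cases "r \<le> d")
    case True
    have "0 \<le> 12 * L / \<sigma> * d" using L_pos \<sigma> nn by simp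
    with True show ?thesis by (simp add: algebra_simps)
  next
    case False
    hence rd: "d \<le> r" "0 < r" using nn by auto
    have "(r + d) * (L * d ^ 2) \<le> (2 * r) * (L * (d * r))"
      using rd nn L_pos by (intro mult_mono) (auto simp: power2_eq_square intro: mult_left_mono)
    moreover have "L * d * (r + d) ^ 2 \<le> L * d * (2 * r) ^ 2"
      using rd nn L_pos by (intro mult_left_mono power_mono) auto
    ultimately have "\<sigma> / 2 * r * (r * (r - d)) \<le> (2 * r) * (L * (d * r)) + L * d * (2 * r) ^ 2"
      using main by linarith
    hence "(\<sigma> / 2 * (r - d)) * r\<^sup>2 \<le> (6 * L * d) * r\<^sup>2"
      by (simp add: power2_eq_square algebra_simps)
    hence "\<sigma> / 2 * (r - d) \<le> 6 * L * d" using rd by simp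
    thus ?thesis using \<sigma> by (simp add: field_simps)
  qed
  thus ?thesis by (simp add: r_def d_def s_def v_def)
qed

section \<open>Star-convexity and quadratic growth\<close>

text \<open>Along the segment to a minimizer, star-convexity keeps \<open>f\<close> below its chord; at \<open>y\<close> the derivative in
  that direction is then at most the slope of the chord.\<close>

lemma star_convex_gradient_ineq:
  assumes "star_convex f" and u: "u \<in> minimizers f"
  shows "f y - f u \<le> gradient f y \<bullet> (y - u)"
proof (rule ccontr)
  assume "\<not> ?thesis"
  hence pos: "0 < gradient f y \<bullet> (u - y) + (f y - f u)" by (simp add: inner_diff_right)
  define \<phi> where "\<phi> t = f (y + t *\<^sub>R (u - y)) + t * (f y - f u)" for t
  have "(\<phi> has_real_derivative gradient f y \<bullet> (u - y) + (f y - f u)) (at 0)"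
    unfolding \<phi>_def[abs_def]
    using has_real_derivative_line[of y "u - y" 0] by (auto intro!: derivative_eq_intros)
  from DERIV_pos_inc_right[OF this pos] obtain e where
    e: "e > 0" "\<And>h. 0 < h \<Longrightarrow> h < e \<Longrightarrow> \<phi> 0 < \<phi> (0 + h)" by blast
  define t where "t = min (e / 2) 1"
  have t: "0 < t" "t < e" "t \<le> 1" using e by (auto simp: t_def)
  have "f (t *\<^sub>R u + (1 - t) *\<^sub>R y) \<le> t * f u + (1 - t) * f y"
    using assms t by (simp add: star_convex_def min_value_eq[OF u])
  moreover have "t *\<^sub>R u + (1 - t) *\<^sub>R y = y + t *\<^sub>R (u - y)" by (simp add: algebra_simps)
  ultimately have "\<phi> t \<le> \<phi> 0" by (simp add: \<phi>_def algebra_simps)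
  with e(2)[OF t(1,2)] show False by simp
qed

text \<open>The gap is at least quadratic in the distance by growth, and at most gradient norm times distance by
  star-convexity; one factor of the distance cancels.\<close>

lemma gradient_error_bound:
  assumes "star_convex f" and u: "u \<in> minimizers f" and d: "infdist y (minimizers f) = norm (y - u)"
    and growth: "\<alpha> / 2 * (infdist y (minimizers f))\<^sup>2 \<le> f y - f u" and "0 < \<alpha>"
  shows "infdist y (minimizers f) \<le> 2 / \<alpha> * norm (gradient f y)"
proof (cases "norm (y - u) = 0")
  case True
  thus ?thesis using d \<open>0 < \<alpha>\<close> by simp
next
  case False
  have "\<alpha> / 2 * norm (y - u) ^ 2 \<le> norm (gradient f y) * norm (y - u)"
    using growth star_convex_gradient_ineq[OF assms(1) u, of y]
      norm_cauchy_schwarz[of "gradient f y" "y - u"] d by simp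
  hence "\<alpha> / 2 * norm (y - u) \<le> norm (gradient f y)"
    using False by (simp add: power2_eq_square)
  thus ?thesis using \<open>0 < \<alpha>\<close> by (simp add: d field_simps)
qed

lemma nearest_minimizer:
  assumes "minimizers f \<noteq> {}"
  obtains u where "u \<in> minimizers f" "infdist y (minimizers f) = norm (u - y)"
proof -
  have "minimizers f = (\<Inter>y. {x. f x \<le> f y})" by (auto simp: minimizers_def)
  hence "closed (minimizers f)"
    by (auto intro!: closed_INT closed_Collect_le continuous_f)
  from distance_attains_inf[OF this assms, of y] obtain u
    where u: "u \<in> minimizers f" "\<And>z. z \<in> minimizers f \<Longrightarrow> dist y u \<le> dist y z" by blast
  have "dist y u \<le> infdist y (minimizers f)"
    unfolding infdist_notempty[OF assms] by (rule cINF_greatest[OF assms]) (rule u(2))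
  with infdist_le[OF u(1), of y] have "infdist y (minimizers f) = norm (u - y)"
    by (simp add: dist_norm norm_minus_commute)
  with u(1) that show ?thesis by blast
qed

text \<open>The competitor for the model minimum is the point a fraction \<open>t\<close> of the way to the minimizer.\<close>

lemma gap_decrease:
  assumes sc: "star_convex f" and u: "u \<in> minimizers f" "u \<in> F" and y: "y \<in> F"
    and p: "f p \<le> min_value (cubic_model f \<sigma> y)" "p' \<in> minimizers (cubic_model f \<sigma> y)"
    and "\<sigma> \<le> 2 * L" and t: "0 \<le> t" "t \<le> 1"
  shows "f p - f u \<le> (1 - t) * (f y - f u) + 2 * L * (t * norm (u - y)) ^ 3"
proof -
  let ?q = "t *\<^sub>R u + (1 - t) *\<^sub>R y"
  have q: "?q \<in> F" using convexD_alt[OF convex_F y u(2) t] by (simp add: add.commute)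
  have "f p \<le> cubic_model f \<sigma> y ?q"
    using p min_value_eq[OF p(2)] by (auto simp: minimizers_def intro: order_trans)
  also have "\<dots> \<le> f ?q + 2 * L * norm (?q - y) ^ 3"
    by (rule cubic_model_le[OF y q]) fact
  also have "?q - y = t *\<^sub>R (u - y)" by (simp add: algebra_simps)
  also have "norm (t *\<^sub>R (u - y)) = t * norm (u - y)" using t by simp
  finally have "f p \<le> f ?q + 2 * L * (t * norm (u - y)) ^ 3" .
  moreover have "f ?q \<le> t * f u + (1 - t) * f y"
    using sc u t by (simp add: star_convex_def min_value_eq[OF u(1)])
  ultimately show ?thesis by (simp add: algebra_simps)
qed

end

section \<open>Quadratic convergence\<close>

theorem corollary2:
  fixes f :: "real ^ 'n \<Rightarrow> real"
    and F :: "(real ^ 'n) set"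
    and L sbar :: real
    and x0 :: "real ^ 'n"
    and x :: "nat \<Rightarrow> real ^ 'n"
  assumes "twice_continuously_differentiable f"
    and "minimizers f \<noteq> {}"
    and "closed F" and "convex F"
    and "sublevel_set f x0 \<subseteq> interior F"
    and "L > 0"
    and "\<forall>y\<in>F. \<forall>z\<in>F. op_norm (hessian f y - hessian f z) \<le> L * norm (y - z)"
    and "star_convex f"
    and "globally_nondegenerate f"
    and "0 < sbar" and "sbar \<le> L"
    and "CR_iterates f L sbar x0 x"
    and "\<exists>k. bounded (sublevel_set f (x k))"
  shows "\<exists>xs \<in> minimizers f. converges_Q_quadratically x xs"
proof -
  interpret lipschitz_hessian f F L by unfold_locales fact+
  let ?X = "minimizers f"
  define d where "d k = infdist (x k) ?X" for k
  define \<delta> where "\<delta> k = f (x k) - min_value f" for k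
  have dnn: "0 \<le> d k" for k by (simp add: d_def infdist_nonneg)
  have fmin: "min_value f \<le> f z" for z
    using \<open>?X \<noteq> {}\<close> min_value_eq[of _ f] by (force simp: minimizers_def)
  hence \<delta>nn: "0 \<le> \<delta> k" for k by (simp add: \<delta>_def)
  obtain \<alpha> where \<alpha>: "\<alpha> > 0" and growth: "\<And>z. \<alpha> / 2 * (infdist z ?X)\<^sup>2 \<le> f z - min_value f"
    using \<open>globally_nondegenerate f\<close> unfolding globally_nondegenerate_def by blast
  obtain \<sigma> where \<sigma>: "\<And>k. sbar \<le> \<sigma> k" "\<And>k. \<sigma> k \<le> 2 * L"
    and xmin: "\<And>k. x (Suc k) \<in> minimizers (cubic_model f (\<sigma> k) (x k))"
    and acc: "\<And>k. f (x (Suc k)) \<le> min_value (cubic_model f (\<sigma> k) (x k))"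
  proof -
    have "\<forall>k. \<exists>\<sigma>. \<sigma> \<in> {sbar..2 * L} \<and> x (Suc k) \<in> minimizers (cubic_model f \<sigma> (x k)) \<and>
        f (x (Suc k)) \<le> min_value (cubic_model f \<sigma> (x k))"
      using \<open>CR_iterates f L sbar x0 x\<close> unfolding CR_iterates_def by blast
    from choice[OF this] show ?thesis using that by auto
  qed
  have \<sigma>pos: "0 < \<sigma> k" for k using \<sigma>(1)[of k] \<open>0 < sbar\<close> by linarith
  \<comment> \<open>Monotone decrease keeps the iterates in the initial sublevel set, where the Hessian is Lipschitz.\<close>
  have "f (x (Suc k)) \<le> f (x k)" for k
  proof -
    have "min_value (cubic_model f (\<sigma> k) (x k)) \<le> cubic_model f (\<sigma> k) (x k) (x k)"
      using xmin[of k] min_value_eq[OF xmin[of k]] by (simp add: minimizers_def)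
    thus ?thesis using acc[of k] by (simp add: cubic_model_def)
  qed
  hence "f (x k) \<le> f (x 0)" for k by (induction k) (auto intro: order_trans)
  moreover have "x 0 = x0" using \<open>CR_iterates f L sbar x0 x\<close> by (simp add: CR_iterates_def)
  ultimately have xint: "x k \<in> interior F" for k
    using \<open>sublevel_set f x0 \<subseteq> interior F\<close> by (auto simp: sublevel_set_def)
  hence xF: "x k \<in> F" for k using interior_subset by blast
  have Xint: "u \<in> interior F" if "u \<in> ?X" for u
    using that \<open>sublevel_set f x0 \<subseteq> interior F\<close> by (auto simp: sublevel_set_def minimizers_def)
  have "\<exists>u. u \<in> ?X \<and> d k = norm (u - x k)" for k
    using nearest_minimizer[OF \<open>?X \<noteq> {}\<close>, of "x k"] unfolding d_def by metis
  then obtain u where u: "\<And>k. u k \<in> ?X" "\<And>k. d k = norm (u k - x k)" by metis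

  have step: "norm (x (Suc k) - x k) \<le> (1 + 12 * L / sbar) * d k" for k
  proof -
    have "norm (x (Suc k) - x k) \<le> (1 + 12 * L / \<sigma> k) * d k"
      using step_length_le[OF xint xmin u(1) Xint[OF u(1)] \<sigma>pos] u(2) by metis
    also have "\<dots> \<le> (1 + 12 * L / sbar) * d k"
      using \<sigma>(1)[of k] \<open>0 < sbar\<close> \<open>L > 0\<close> dnn
      by (intro mult_right_mono add_left_mono divide_left_mono) auto
    finally show ?thesis .
  qed
  define B where "B = 2 / \<alpha> * (2 * L * (1 + 12 * L / sbar)\<^sup>2)"
  have quad: "d (Suc k) \<le> B * (d k)\<^sup>2" for k
  proof -
    have "d (Suc k) \<le> 2 / \<alpha> * norm (gradient f (x (Suc k)))"
      unfolding d_def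
    proof (rule gradient_error_bound[OF \<open>star_convex f\<close> u(1)[of "Suc k"] _ _ \<alpha>])
      show "infdist (x (Suc k)) ?X = norm (x (Suc k) - u (Suc k))"
        using u(2)[of "Suc k"] by (simp add: d_def norm_minus_commute)
      show "\<alpha> / 2 * (infdist (x (Suc k)) ?X)\<^sup>2 \<le> f (x (Suc k)) - f (u (Suc k))"
        using growth min_value_eq[OF u(1)[of "Suc k"]] by simp
    qed
    also have "\<dots> \<le> 2 / \<alpha> * (2 * L * norm (x (Suc k) - x k) ^ 2)"
      using \<alpha> gradient_at_model_minimizer[OF xint xmin xF \<sigma>pos \<sigma>(2)] by (intro mult_left_mono) auto
    also have "\<dots> \<le> 2 / \<alpha> * (2 * L * ((1 + 12 * L / sbar) * d k) ^ 2)"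
      using \<alpha> \<open>L > 0\<close> step by (intro mult_left_mono power_mono) auto
    finally show ?thesis by (simp add: B_def power_mult_distrib mult_ac)
  qed
  have "\<delta> \<longlonglongrightarrow> 0"
  proof (rule gap_tendsto_zero_if_cubic_tradeoff[where d = d and c = "2 * L" and b = "2 / \<alpha>"])
    fix k :: nat and t :: real assume t: "0 \<le> t" "t \<le> 1"
    show "\<delta> (Suc k) \<le> (1 - t) * \<delta> k + 2 * L * (t * d k) ^ 3"
      using gap_decrease[OF \<open>star_convex f\<close> u(1)[of k] _ xF acc xmin \<sigma>(2) t] Xint[OF u(1)[of k]]
        interior_subset min_value_eq[OF u(1)[of k]] u(2)[of k] by (auto simp: \<delta>_def)
  next
    fix k
    show "(d k)\<^sup>2 \<le> 2 / \<alpha> * \<delta> k"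
      using growth[of "x k"] \<alpha> by (simp add: d_def \<delta>_def field_simps)
  qed (use \<alpha> \<open>L > 0\<close> dnn \<delta>nn in auto)
  hence "(\<lambda>k. sqrt (2 / \<alpha> * \<delta> k)) \<longlonglongrightarrow> sqrt (2 / \<alpha> * 0)"
    by (intro tendsto_intros)
  moreover have "d k \<le> sqrt (2 / \<alpha> * \<delta> k)" for k
    using growth[of "x k"] \<alpha> by (intro real_le_rsqrt) (simp add: d_def \<delta>_def field_simps)
  ultimately have d0: "d \<longlonglongrightarrow> 0"
    using tendsto_sandwich[of "\<lambda>_. 0" d sequentially "\<lambda>k. sqrt (2 / \<alpha> * \<delta> k)" 0] dnn by simp
  obtain l M where l: "x \<longlonglongrightarrow> l" and M: "M > 0"
    "\<forall>\<^sub>F k in sequentially. norm (x (Suc k) - l) \<le> M * (d k)\<^sup>2"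
    using convergent_with_quadratic_error[OF step quad d0 dnn] by blast
  have "(\<lambda>k. f (x k)) \<longlonglongrightarrow> f l"
    using continuous_f[of UNIV] l continuous_on_tendsto_compose[of UNIV f x l] by simp
  moreover have "(\<lambda>k. f (x k)) \<longlonglongrightarrow> min_value f"
    using tendsto_add[OF \<open>\<delta> \<longlonglongrightarrow> 0\<close> tendsto_const[of "min_value f"]] by (simp add: \<delta>_def)
  ultimately have "f l = min_value f" by (rule LIMSEQ_unique)
  hence lX: "l \<in> ?X" using fmin by (simp add: minimizers_def)
  have "d k \<le> norm (x k - l)" for k
    unfolding d_def using infdist_le[OF lX] by (simp add: dist_norm)
  hence "M * (d k)\<^sup>2 \<le> M * (norm (x k - l))\<^sup>2" for k
    using M dnn by (intro mult_left_mono power_mono) auto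
  hence "\<forall>\<^sub>F k in sequentially. norm (x (Suc k) - l) \<le> M * (norm (x k - l))\<^sup>2"
    by (intro eventually_mono[OF M(2)]) (rule order_trans)
  with l M(1) lX show ?thesis unfolding converges_Q_quadratically_def by blast
qed

end
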